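(* Let $f:\mathbb{Z}^n\to\mathbb{Z}\cup\{+\infty\}$ be an integer-valued integrally convex function, let $x\in\operatorname{dom}f$, and let $B$ be an integral box. If $\partial f(x)\cap B$ is nonempty, then $\partial f(x)\cap B$ is a polyhedron containing an integer vector. If, in addition, $\partial f(x)\cap B$ is bounded, then $\partial f(x)\cap B$ has an integral vertex.
   Context: $\operatorname{dom}f=\{x\in\mathbb{Z}^n\mid f(x)<+\infty\}$. Integral convexity: for $x\in\mathbb{R}^n$ let $N(x)=\{z\in\mathbb{Z}^n\mid |x_i-z_i|<1\ (i=1,\dots,n)\}$. For $f:\mathbb{Z}^n\to\mathbb{R}\cup\{+\infty\}$ with $\operatorname{dom}f\ne\emptyset$, the local convex extension is $\tilde f(x)=\min\{\sum_{y\in N(x)}\lambda_y f(y)\mid \sum_{y\in N(x)}\lambda_y y=x,\ \sum_{y\in N(x)}\lambda_y=1,\ \lambda_y\ge 0\ (y\in N(x))\}$ for $x\in\mathbb{R}^n$. The function $f$ is integrally convex if $\tilde f:\mathbb{R}^n\to\mathbb{R}\cup\{+\infty\}$ is convex. Subdifferential: for $x\in\operatorname{dom}f$, $\partial f(x)=\{p\in\mathbb{R}^n\mid f(y)-f(x)\ge\langle p,y-x\rangle\ \text{for all }y\in\mathbb{Z}^n\}$. An integral box is a set $B=\{p\in\mathbb{R}^n\mid\alpha\le p\le\beta\}$ with $\alpha\in(\mathbb{Z}\cup\{-\infty\})^n$, $\beta\in(\mathbb{Z}\cup\{+\infty\})^n$, $\alpha\le\beta$ (componentwise). *)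

theory Defs
  imports "HOL-Analysis.Analysis"
begin

text \<open>
  Functions with values in \<open>\<real> \<union> {+\<infinity>}\<close> are modelled as \<^typ>\<open>ereal\<close>-valued functions that never
  take the value \<open>-\<infinity>\<close>. The space of integer vectors is \<open>int ^ 'n\<close>, embedded into \<open>real ^ 'n\<close>.
\<close>

definition real_vec :: "int ^ 'n \<Rightarrow> real ^ 'n" where
  "real_vec z = (\<chi> i. real_of_int (z $ i))"

definition eff_dom :: "(int ^ 'n \<Rightarrow> ereal) \<Rightarrow> (int ^ 'n) set" where
  "eff_dom f = {x. f x < \<infinity>}"

definition integral_neighborhood :: "real ^ 'n \<Rightarrow> (int ^ 'n) set" where
  "integral_neighborhood x = {z. \<forall>i. \<bar>x $ i - real_of_int (z $ i)\<bar> < 1}"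

text \<open>The sums over neighborhoods below are finite sums.\<close>

lemma finite_integral_neighborhood: "finite (integral_neighborhood (x :: real ^ 'n))"
proof -
  let ?P = "PiE (UNIV :: 'n set) (\<lambda>i. {\<lfloor>x $ i\<rfloor> - 1..\<lceil>x $ i\<rceil> + 1})"
  have "vec_nth ` integral_neighborhood x \<subseteq> ?P"
  proof (clarsimp simp: integral_neighborhood_def PiE_def)
    fix z :: "int ^ 'n" and i
    assume "\<forall>i. \<bar>x $ i - real_of_int (z $ i)\<bar> < 1"
    then have "\<bar>x $ i - real_of_int (z $ i)\<bar> < 1" by blast
    then show "\<lfloor>x $ i\<rfloor> - 1 \<le> z $ i \<and> z $ i \<le> \<lceil>x $ i\<rceil> + 1"
      by linarith
  qed
  moreover have "finite ?P"
    by (intro finite_PiE) auto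
  ultimately have "finite (vec_nth ` integral_neighborhood x)"
    by (rule finite_subset)
  then show ?thesis
    by (rule finite_imageD) (auto simp: inj_on_def vec_eq_iff)
qed

text \<open>
  The feasible set is a nonempty polytope and the objective is affine on its face of weights
  supported in the effective domain (and \<open>+\<infinity>\<close> off that face), so for \<open>f > -\<infinity>\<close> the infimum is
  a minimum. Note that \<open>0 * \<infinity> = 0\<close> in \<^typ>\<open>ereal\<close>, which is the usual convention here: points
  outside the effective domain do not contribute if their weight is zero.
\<close>

definition local_convex_extension :: "(int ^ 'n \<Rightarrow> ereal) \<Rightarrow> real ^ 'n \<Rightarrow> ereal" where
  "local_convex_extension f x =
     Inf {\<Sum>y\<in>integral_neighborhood x. ereal (w y) * f y | w :: int ^ 'n \<Rightarrow> real.
            (\<Sum>y\<in>integral_neighborhood x. w y *\<^sub>R real_vec y) = x \<and>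
            (\<Sum>y\<in>integral_neighborhood x. w y) = 1 \<and>
            (\<forall>y\<in>integral_neighborhood x. 0 \<le> w y)}"

text \<open>The extended-valued analogue of \<^const>\<open>convex_on\<close> on the whole space.\<close>

definition ereal_convex :: "('a :: real_vector \<Rightarrow> ereal) \<Rightarrow> bool" where
  "ereal_convex g \<longleftrightarrow>
     (\<forall>x y. \<forall>u\<ge>0. \<forall>v\<ge>0. u + v = 1 \<longrightarrow>
        g (u *\<^sub>R x + v *\<^sub>R y) \<le> ereal u * g x + ereal v * g y)"

definition integrally_convex :: "(int ^ 'n \<Rightarrow> ereal) \<Rightarrow> bool" where
  "integrally_convex f \<longleftrightarrow>
     (\<forall>z. f z \<noteq> -\<infinity>) \<and> eff_dom f \<noteq> {} \<and> ereal_convex (local_convex_extension f)"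

definition integer_valued :: "(int ^ 'n \<Rightarrow> ereal) \<Rightarrow> bool" where
  "integer_valued f \<longleftrightarrow> (\<forall>z. f z = \<infinity> \<or> (\<exists>k::int. f z = ereal (real_of_int k)))"

text \<open>Only meaningful for \<open>x \<in> eff_dom f\<close>.\<close>

definition subdifferential :: "(int ^ 'n \<Rightarrow> ereal) \<Rightarrow> int ^ 'n \<Rightarrow> (real ^ 'n) set" where
  "subdifferential f x = {p. \<forall>y. f y - f x \<ge> ereal (p \<bullet> (real_vec y - real_vec x))}"

definition integral_box :: "(real ^ 'n) set \<Rightarrow> bool" where
  "integral_box B \<longleftrightarrow>
     (\<exists>\<alpha> \<beta> :: ereal ^ 'n.
        (\<forall>i. \<alpha> $ i = -\<infinity> \<or> (\<exists>k::int. \<alpha> $ i = ereal (real_of_int k))) \<and>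
        (\<forall>i. \<beta> $ i = \<infinity> \<or> (\<exists>k::int. \<beta> $ i = ereal (real_of_int k))) \<and>
        (\<forall>i. \<alpha> $ i \<le> \<beta> $ i) \<and>
        B = {p. \<forall>i. \<alpha> $ i \<le> ereal (p $ i) \<and> ereal (p $ i) \<le> \<beta> $ i})"

definition integer_vector :: "real ^ 'n \<Rightarrow> bool" where
  "integer_vector p \<longleftrightarrow> (\<forall>i. p $ i \<in> \<int>)"

end

theory Submission
  imports Defs
begin

text \<open>
  By convexity of the local extension, \<open>\<partial>f(x)\<close> is cut out by the inequalities
  \<open>\<langle>p, d\<rangle> \<le> f(x + d) - f(x)\<close> with \<open>d \<in> {-1, 0, 1}\<^sup>n\<close>. Eliminate coordinates by Fourier--Motzkin.
  Adding an inequality with \<open>d\<^sub>i = 1\<close> to one with \<open>d'\<^sub>i = -1\<close> gives nothing new: by integral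
  convexity at the midpoint of \<open>d\<close> and \<open>d'\<close>, the sum is implied by inequalities with
  \<open>i\<close>-th coefficient zero. Combining with the box bounds only shifts right-hand sides, and preserves
  the midpoint property. Hence all coefficients stay in \<open>{-1, 0, 1}\<close> and all bounds stay integral, so
  back substitution yields an integer vector; taking the largest value in each coordinate makes it
  extreme. Truncating the box far from the origin reduces everything to bounded boxes.
\<close>

section \<open>Integral elimination\<close>

text \<open>Points and coefficients are functions on the whole index type, read only on
  \<open>S\<close>, so that a coordinate is eliminated by shrinking \<open>S\<close>.\<close>

definition feasible ::
    "'a set \<Rightarrow> ('a \<Rightarrow> int) \<Rightarrow> ('a \<Rightarrow> int) \<Rightarrow> (('a \<Rightarrow> int) \<times> int) set \<Rightarrow> ('a \<Rightarrow> real) \<Rightarrow> bool" where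
  "feasible S a b C p \<longleftrightarrow>
     (\<forall>i\<in>S. of_int (a i) \<le> p i \<and> p i \<le> of_int (b i)) \<and>
     (\<forall>(d, k)\<in>C. (\<Sum>i\<in>S. p i * of_int (d i)) \<le> of_int k)"

text \<open>The dual form of midpoint convexity: instead of a convex combination of points near
  \<open>(d + d') / 2\<close>, it speaks about affine minorants on those points.\<close>

definition midpoint_closed :: "'a set \<Rightarrow> (('a \<Rightarrow> int) \<times> int) set \<Rightarrow> bool" where
  "midpoint_closed S C \<longleftrightarrow>
     (\<forall>(d, k)\<in>C. \<forall>(d', k')\<in>C. \<forall>(q :: 'a \<Rightarrow> real) (r :: real).
        (\<forall>(z, l)\<in>C. (\<forall>i\<in>S. \<bar>2 * z i - (d i + d' i)\<bar> < 2) \<longrightarrow>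
            (\<Sum>i\<in>S. q i * of_int (z i)) + r \<le> of_int l) \<longrightarrow>
        (\<Sum>i\<in>S. q i * of_int (d i + d' i)) + 2 * r \<le> of_int (k + k'))"

lemma midpoint_closedI:
  assumes "\<And>d k d' k' (q :: 'a \<Rightarrow> real) r. (d, k) \<in> C \<Longrightarrow> (d', k') \<in> C \<Longrightarrow>
      (\<And>z l. (z, l) \<in> C \<Longrightarrow> (\<And>i. i \<in> S \<Longrightarrow> \<bar>2 * z i - (d i + d' i)\<bar> < 2) \<Longrightarrow>
            (\<Sum>i\<in>S. q i * of_int (z i)) + r \<le> of_int l) \<Longrightarrow>
      (\<Sum>i\<in>S. q i * of_int (d i + d' i)) + 2 * r \<le> real_of_int (k + k')"
  shows "midpoint_closed S C"
  unfolding midpoint_closed_def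
proof (intro ballI allI impI, clarsimp simp del: of_int_add, goal_cases)
  case (1 d k d' k' q r)
  show ?case
    by (rule assms[OF 1(1,2)]) (use 1(3) in blast)
qed

lemma midpoint_closedD:
  assumes "midpoint_closed S C" "(d, k) \<in> C" "(d', k') \<in> C"
    and "\<And>z l. (z, l) \<in> C \<Longrightarrow> (\<And>i. i \<in> S \<Longrightarrow> \<bar>2 * z i - (d i + d' i)\<bar> < 2) \<Longrightarrow>
            (\<Sum>i\<in>S. q i * of_int (z i)) + r \<le> of_int l"
  shows "(\<Sum>i\<in>S. q i * of_int (d i + d' i)) + 2 * r \<le> real_of_int (k + k')"
  using assms unfolding midpoint_closed_def by fast

section \<open>One elimination step\<close>

text \<open>For \<open>l \<le> u\<close> and \<open>j\<close> in \<open>{-1, 0, 1}\<close> this is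
  the minimum of \<open>t * j\<close> over \<open>l \<le> t \<le> u\<close>, the least contribution
  of the eliminated coordinate.\<close>

definition elim_cost :: "int \<Rightarrow> int \<Rightarrow> int \<Rightarrow> int" where
  "elim_cost l u j = (if j = 1 then l else if j = -1 then - u else 0)"

text \<open>The Fourier-Motzkin step in which each constraint meets only the box bounds of
  coordinate \<open>n\<close>. Pairs of opposite sign are not added up: under
  \<open>midpoint_closed\<close> their sums are already implied.\<close>

definition eliminate ::
    "'a \<Rightarrow> int \<Rightarrow> int \<Rightarrow> (('a \<Rightarrow> int) \<times> int) set \<Rightarrow> (('a \<Rightarrow> int) \<times> int) set" where
  "eliminate n l u C = (\<lambda>(d, k). (d, k - elim_cost l u (d n))) ` C"

lemma elim_cost_le:
  fixes t :: real
  assumes "j \<in> {-1, 0, 1}" "of_int l \<le> t" "t \<le> of_int u"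
  shows "of_int (elim_cost l u j) \<le> t * of_int j"
  using assms by (auto simp: elim_cost_def)

text \<open>The term of coordinate \<open>n\<close> is replaced by its least value. This is the
  projection direction; lifting back is done in \<open>integral_feasible_exists\<close> for the
  chosen integer point.\<close>

lemma feasible_eliminate:
  assumes "finite S" "n \<notin> S" "\<forall>(d, k)\<in>C. d n \<in> {-1, 0, 1}"
    and "feasible (insert n S) a b C p"
  shows "feasible S a b (eliminate n (a n) (b n) C) p"
proof -
  have "(\<Sum>i\<in>S. p i * of_int (d i)) \<le> of_int (k - elim_cost (a n) (b n) (d n))"
    if "(d, k) \<in> C" for d k
  proof -
    have "(\<Sum>i\<in>insert n S. p i * of_int (d i)) \<le> of_int k"
      using assms(4) that unfolding feasible_def by fast
    moreover have "of_int (elim_cost (a n) (b n) (d n)) \<le> p n * of_int (d n)"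
      using assms(3,4) that by (intro elim_cost_le) (auto simp: feasible_def)
    ultimately show ?thesis
      using assms(1,2) by simp
  qed
  then show ?thesis
    using assms(4) unfolding feasible_def eliminate_def by auto
qed

text \<open>The cost \<^const>\<open>elim_cost\<close> is linear on \<open>{-1, 0}\<close> and on \<open>{0, 1}\<close>, so on the coordinate
  neighborhood of a midpoint it can be absorbed into the affine minorant.\<close>

lemma midpoint_closed_eliminate:
  assumes "finite S" "n \<notin> S" and range: "\<forall>(d, k)\<in>C. d n \<in> {-1, 0, 1}"
    and "l \<le> u" and mid: "midpoint_closed (insert n S) C"
  shows "midpoint_closed S (eliminate n l u C)"
proof -
  have elim_mid: "(\<Sum>i\<in>S. q i * of_int (d i + d' i)) + 2 * r \<le>
      real_of_int ((k - elim_cost l u (d n)) + (k' - elim_cost l u (d' n)))"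
    if dk: "(d, k) \<in> C" "(d', k') \<in> C"
      and minorant: "\<And>z m. (z, m) \<in> C \<Longrightarrow> (\<And>i. i \<in> S \<Longrightarrow> \<bar>2 * z i - (d i + d' i)\<bar> < 2) \<Longrightarrow>
            (\<Sum>i\<in>S. q i * of_int (z i)) + r \<le> of_int (m - elim_cost l u (z n))"
    for d k d' k' and q :: "'a \<Rightarrow> real" and r
  proof -
    \<comment> \<open>Nearby \<open>z\<close> have \<open>z n\<close> in \<open>{0, 1}\<close> if
      \<open>d n + d' n > 0\<close> and in \<open>{-1, 0}\<close> otherwise; the cost has slope
      \<open>l\<close> on the former and \<open>u\<close> on the latter.\<close>
    define \<kappa> where "\<kappa> = real_of_int (if d n + d' n > 0 then l else u)"
    have sums: "(\<Sum>i\<in>insert n S. (q(n := \<kappa>)) i * y i) = \<kappa> * y n + (\<Sum>i\<in>S. q i * y i)" for y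
    proof -
      have "(\<Sum>i\<in>S. (q(n := \<kappa>)) i * y i) = (\<Sum>i\<in>S. q i * y i)"
        using assms(2) by (intro sum.cong) auto
      then show ?thesis
        using assms(1,2) by simp
    qed
    have dn: "d n \<in> {-1, 0, 1}" "d' n \<in> {-1, 0, 1}"
      using range dk by auto
    have "(\<Sum>i\<in>insert n S. (q(n := \<kappa>)) i * of_int (d i + d' i)) + 2 * r \<le> real_of_int (k + k')"
    proof (rule midpoint_closedD[OF mid dk])
      fix z m
      assume z: "(z, m) \<in> C"
        and near: "\<And>i. i \<in> insert n S \<Longrightarrow> \<bar>2 * z i - (d i + d' i)\<bar> < 2"
      have "z n \<in> {-1, 0, 1}"
        using range z by auto
      moreover have "\<bar>2 * z n - (d n + d' n)\<bar> < 2"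
        using near by blast
      ultimately have "\<kappa> * of_int (z n) = of_int (elim_cost l u (z n))"
        by (auto simp: \<kappa>_def elim_cost_def)
      moreover have "(\<Sum>i\<in>S. q i * of_int (z i)) + r \<le> of_int (m - elim_cost l u (z n))"
        using minorant[OF z] near by blast
      ultimately show "(\<Sum>i\<in>insert n S. (q(n := \<kappa>)) i * of_int (z i)) + r \<le> of_int m"
        unfolding sums by simp
    qed
    \<comment> \<open>\<open>d\<close> and \<open>d'\<close> themselves need not be near the
      midpoint, so here there is only an inequality, from \<open>l \<le> \<kappa> \<le> u\<close>.
      Its direction is the right one, as costs are subtracted from the bounds.\<close>
    moreover have "of_int (elim_cost l u (d n)) \<le> \<kappa> * of_int (d n)"
      "of_int (elim_cost l u (d' n)) \<le> \<kappa> * of_int (d' n)"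
      using dn \<open>l \<le> u\<close> by (auto intro!: elim_cost_le simp: \<kappa>_def)
    ultimately show ?thesis
      unfolding sums by (simp add: distrib_left)
  qed
  show ?thesis
  proof (rule midpoint_closedI)
    fix d k d' k' and q :: "'a \<Rightarrow> real" and r
    assume "(d, k) \<in> eliminate n l u C" "(d', k') \<in> eliminate n l u C"
      and minorant: "\<And>z m. (z, m) \<in> eliminate n l u C \<Longrightarrow>
            (\<And>i. i \<in> S \<Longrightarrow> \<bar>2 * z i - (d i + d' i)\<bar> < 2) \<Longrightarrow>
            (\<Sum>i\<in>S. q i * of_int (z i)) + r \<le> of_int m"
    then obtain h h' where h: "(d, h) \<in> C" "k = h - elim_cost l u (d n)"
        "(d', h') \<in> C" "k' = h' - elim_cost l u (d' n)"
      by (auto simp: eliminate_def)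
    have "(z, m - elim_cost l u (z n)) \<in> eliminate n l u C" if "(z, m) \<in> C" for z m
      using that by (force simp: eliminate_def)
    then show "(\<Sum>i\<in>S. q i * of_int (d i + d' i)) + 2 * r \<le> real_of_int (k + k')"
      unfolding h(2,4) using elim_mid[OF h(1,3)] minorant by blast
  qed
qed

section \<open>Back substitution\<close>

text \<open>The weighted gaps \<open>m - s\<close> and \<open>m - t\<close> are nonnegative and add
  up to zero.\<close>

lemma convex_comb_eq_upper_bound:
  fixes s t m u :: real
  assumes "m = (1 - u) * s + u * t" "s \<le> m" "t \<le> m" "0 < u" "u < 1"
  shows "s = m \<and> t = m"
proof -
  have "(1 - u) * (m - s) + u * (m - t) = 0"
    using assms(1) by (simp add: algebra_simps)
  moreover have "0 \<le> (1 - u) * (m - s)" "0 \<le> u * (m - t)"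
    using assms by auto
  ultimately have "(1 - u) * (m - s) = 0" "u * (m - t) = 0"
    by linarith+
  then show ?thesis
    using assms(4,5) by auto
qed

text \<open>Among the feasible values of the eliminated coordinate the largest is chosen, so that the
  point obtained is lexicographically maximal and hence extreme.\<close>

lemma integral_feasible_exists:
  assumes "finite S" "finite C" "\<forall>(d, k)\<in>C. \<forall>i\<in>S. d i \<in> {-1, 0, 1}"
    and "midpoint_closed S C" "feasible S a b C p"
  shows "\<exists>m :: 'a \<Rightarrow> int. feasible S a b C (\<lambda>i. of_int (m i)) \<and>
      (\<forall>s t u. feasible S a b C s \<longrightarrow> feasible S a b C t \<longrightarrow> 0 < u \<longrightarrow> u < 1 \<longrightarrow>
        (\<forall>i\<in>S. of_int (m i) = (1 - u) * s i + u * t i) \<longrightarrow>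
        (\<forall>i\<in>S. s i = of_int (m i) \<and> t i = of_int (m i)))"
  using assms
proof (induction S arbitrary: C rule: finite_induct)
  \<comment> \<open>Over no coordinates, feasibility says only that all right-hand sides are
    nonnegative. This does not mention the point, so it passes from the real \<open>p\<close> to an
    integer one.\<close>
  case empty
  then show ?case
    by (auto simp: feasible_def)
next
  case (insert n S)
  let ?C = "eliminate n (a n) (b n) C"
  have range: "\<forall>(d, k)\<in>C. d n \<in> {-1, 0, 1}"
    using insert.prems(2) by auto
  have "of_int (a n) \<le> p n" "p n \<le> of_int (b n)"
    using insert.prems(4) by (auto simp: feasible_def)
  then have ab: "a n \<le> b n"
    by linarith
  have C: "finite ?C" "\<forall>(d, k)\<in>?C. \<forall>i\<in>S. d i \<in> {-1, 0, 1}"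
    using insert.prems(1,2) by (auto simp: eliminate_def)
  have mid: "midpoint_closed S ?C"
    using insert.hyps(1,2) range ab insert.prems(3) by (rule midpoint_closed_eliminate)
  have proj: "feasible S a b ?C s" if "feasible (insert n S) a b C s" for s
    using insert.hyps(1,2) range that by (rule feasible_eliminate)
  obtain m where m: "feasible S a b ?C (\<lambda>i. of_int (m i))"
    and ext: "\<And>s t u. feasible S a b ?C s \<Longrightarrow> feasible S a b ?C t \<Longrightarrow> 0 < u \<Longrightarrow> u < 1 \<Longrightarrow>
        (\<forall>i\<in>S. of_int (m i) = (1 - u) * s i + u * t i) \<Longrightarrow>
        (\<forall>i\<in>S. s i = of_int (m i) \<and> t i = of_int (m i))"
    using insert.IH[OF C mid proj[OF insert.prems(4)]]
    by (elim exE conjE) (rule that, assumption, blast)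
  define V where "V d = (\<Sum>i\<in>S. m i * d i)" for d
  have V: "(\<Sum>i\<in>S. real_of_int (m i) * of_int (d i)) = of_int (V d)" for d
    by (simp add: V_def)
  have m_le: "V d \<le> k - elim_cost (a n) (b n) (d n)" if "(d, k) \<in> C" for d k
  proof -
    have "real_of_int (V d) \<le> of_int (k - elim_cost (a n) (b n) (d n))"
      using m that unfolding feasible_def V eliminate_def by fastforce
    then show ?thesis
      by linarith
  qed
  \<comment> \<open>All upper bounds on coordinate \<open>n\<close> once the coordinates in
    \<open>S\<close> are fixed to \<open>m\<close>; they are integers.\<close>
  define U where "U = insert (b n) ((\<lambda>(d, k). k - V d) ` {(d, k)\<in>C. d n = 1})"
  define c where "c = Min U"
  have "finite U" "U \<noteq> {}"
    using insert.prems(1) unfolding U_def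
    by (auto intro!: finite_imageI elim: finite_subset[rotated])
  then have c_le: "\<And>v. v \<in> U \<Longrightarrow> c \<le> v" and cU: "c \<in> U"
    by (auto simp: c_def)
  \<comment> \<open>For a coefficient 1, the reduced constraint at \<open>m\<close> reads
    \<open>V d + a n \<le> k\<close>.\<close>
  have a_le: "a n \<le> c"
    using cU m_le ab by (force simp: U_def elim_cost_def)
  have lower: "V d - k \<le> c" if dk: "(d, k) \<in> C" "d n = -1" for d k
    using cU unfolding U_def
  proof (elim insertE imageE)
    assume "c = b n"
    then show ?thesis
      using m_le[OF dk(1)] dk(2) by (simp add: elim_cost_def)
  next
    fix e assume e: "e \<in> {(d, k)\<in>C. d n = 1}" "c = (case e of (d, k) \<Rightarrow> k - V d)"
    then obtain d' k' where e': "(d', k') \<in> C" "d' n = 1" "c = k' - V d'"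
      by auto
    \<comment> \<open>A lower bound meets an upper bound. As \<open>d n + d' n = 0\<close>, nearby
      \<open>z\<close> have \<open>z n = 0\<close> and cost 0, so \<open>m\<close> gives a minorant
      there by \<open>m_le\<close>, and midpoint closedness yields
      \<open>V d + V d' \<le> k + k'\<close>. The value of \<open>?q\<close> at \<open>n\<close> is
      multiplied by 0 throughout.\<close>
    let ?q = "\<lambda>i. real_of_int ((m(n := 0)) i)"
    have sums: "(\<Sum>i\<in>insert n S. ?q i * of_int (z i)) = of_int (V z)" for z
    proof -
      have "(\<Sum>i\<in>S. ?q i * of_int (z i)) = (\<Sum>i\<in>S. real_of_int (m i) * of_int (z i))"
        using insert.hyps by (intro sum.cong) auto
      then show ?thesis
        using insert.hyps V by simp
    qed
    have "(\<Sum>i\<in>insert n S. ?q i * of_int (d i + d' i)) + 2 * 0 \<le> real_of_int (k + k')"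
    proof (rule midpoint_closedD[OF insert.prems(3) dk(1) e'(1)])
      fix z l
      assume z: "(z, l) \<in> C"
        and near: "\<And>i. i \<in> insert n S \<Longrightarrow> \<bar>2 * z i - (d i + d' i)\<bar> < 2"
      have "\<bar>2 * z n - (d n + d' n)\<bar> < 2"
        using near by blast
      then have "z n = 0"
        using dk(2) e'(2) by simp
      then show "(\<Sum>i\<in>insert n S. ?q i * of_int (z i)) + 0 \<le> of_int l"
        unfolding sums using m_le[OF z] by (simp add: elim_cost_def)
    qed
    then have "V (\<lambda>i. d i + d' i) \<le> k + k'"
      unfolding sums by linarith
    then show ?thesis
      using e'(3) by (simp add: V_def distrib_left sum.distrib)
  qed
  let ?m = "m(n := c)"
  have split_sum: "(\<Sum>i\<in>insert n S. y i * real_of_int (d i)) =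
      y n * of_int (d n) + (\<Sum>i\<in>S. y i * of_int (d i))" for y d
    using insert.hyps by simp
  have sum_m: "(\<Sum>i\<in>insert n S. real_of_int (?m i) * of_int (d i)) = of_int (c * d n + V d)" for d
  proof -
    have "(\<Sum>i\<in>S. real_of_int (?m i) * of_int (d i)) = (\<Sum>i\<in>S. real_of_int (m i) * of_int (d i))"
      using insert.hyps by (intro sum.cong) auto
    then show ?thesis
      unfolding split_sum V by simp
  qed
  have "c * d n + V d \<le> k" if dk: "(d, k) \<in> C" for d k
  proof -
    consider "d n = -1" | "d n = 0" | "d n = 1"
      using bspec[OF range dk] by auto
    then show ?thesis
    proof cases
      case 1
      then show ?thesis
        using lower[OF dk] by simp
    next
      case 2
      then show ?thesis
        using m_le[OF dk] by (simp add: elim_cost_def)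
    next
      case 3
      then have "k - V d \<in> U"
        using dk by (force simp: U_def)
      then show ?thesis
        using c_le 3 by fastforce
    qed
  qed
  then have "(\<Sum>i\<in>insert n S. real_of_int (?m i) * of_int (d i)) \<le> of_int k"
    if "(d, k) \<in> C" for d k
    unfolding sum_m of_int_le_iff using that .
  moreover have "real_of_int (a i) \<le> of_int (?m i) \<and> of_int (?m i) \<le> real_of_int (b i)"
    if "i \<in> insert n S" for i
  proof (cases "i = n")
    case True
    then show ?thesis
      using a_le c_le[of "b n"] by (simp add: U_def)
  next
    case False
    then show ?thesis
      using m that by (simp add: feasible_def)
  qed
  ultimately have "feasible (insert n S) a b C (\<lambda>i. of_int (?m i))"
    unfolding feasible_def by (intro conjI ballI) auto
  moreover have "\<forall>i\<in>insert n S. s i = of_int (?m i) \<and> t i = of_int (?m i)"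
    if st: "feasible (insert n S) a b C s" "feasible (insert n S) a b C t" and u: "0 < u" "u < 1"
      and comb: "\<forall>i\<in>insert n S. of_int (?m i) = (1 - u) * s i + u * t i" for s t u
  proof -
    \<comment> \<open>Both endpoints project into the reduced system, where \<open>m\<close> is
      already extreme.\<close>
    have eqS: "\<forall>i\<in>S. s i = of_int (m i) \<and> t i = of_int (m i)"
    proof (rule ext[OF proj[OF st(1)] proj[OF st(2)] u])
      show "\<forall>i\<in>S. of_int (m i) = (1 - u) * s i + u * t i"
      proof
        fix i assume i: "i \<in> S"
        then have "i \<noteq> n"
          using insert.hyps by auto
        then show "of_int (m i) = (1 - u) * s i + u * t i"
          using comb i by (metis fun_upd_other insertCI)
      qed
    qed
    \<comment> \<open>The constraint attaining the minimum \<open>c\<close> bounds coordinate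
      \<open>n\<close> of every feasible point that agrees with \<open>m\<close> on
      \<open>S\<close>.\<close>
    have le_c: "y n \<le> of_int c"
      if y: "feasible (insert n S) a b C y" "\<forall>i\<in>S. y i = of_int (m i)" for y
      using cU unfolding U_def
    proof (elim insertE imageE)
      assume "c = b n"
      then show ?thesis
        using y(1) by (simp add: feasible_def)
    next
      fix e assume e: "e \<in> {(d, k)\<in>C. d n = 1}" "c = (case e of (d, k) \<Rightarrow> k - V d)"
      then obtain d k where dk: "(d, k) \<in> C" "d n = 1" "c = k - V d"
        by auto
      have "(\<Sum>i\<in>insert n S. y i * of_int (d i)) \<le> of_int k"
        using y(1) dk(1) unfolding feasible_def by fast
      moreover have "(\<Sum>i\<in>S. y i * of_int (d i)) = of_int (V d)"
        unfolding V[symmetric] using y(2) by (intro sum.cong) auto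
      ultimately show ?thesis
        unfolding split_sum using dk(2,3) by simp
    qed
    have "of_int c = (1 - u) * s n + u * t n"
      using comb by (metis fun_upd_same insertI1)
    then have "s n = of_int c \<and> t n = of_int c"
      using convex_comb_eq_upper_bound le_c st eqS u by blast
    then show ?thesis
      using eqS insert.hyps by auto
  qed
  ultimately show ?case
    by blast
qed

section \<open>Integrally convex functions\<close>

lemma real_vec_nth [simp]: "real_vec z $ i = of_int (z $ i)"
  by (simp add: real_vec_def)

lemma integral_neighborhood_real_vec: "integral_neighborhood (real_vec y) = {y}"
proof -
  have "z = y" if "\<forall>i. \<bar>real_of_int (y $ i) - of_int (z $ i)\<bar> < 1" for z
  proof (rule vec_eq_iff[THEN iffD2], rule allI)
    fix i
    have "\<bar>real_of_int (y $ i) - of_int (z $ i)\<bar> < 1"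
      using that by blast
    then show "z $ i = y $ i"
      by linarith
  qed
  then show ?thesis
    by (auto simp: integral_neighborhood_def)
qed

lemma local_convex_extension_real_vec_le: "local_convex_extension f (real_vec y) \<le> f y"
  unfolding local_convex_extension_def integral_neighborhood_real_vec
  by (rule Inf_lower, rule CollectI, rule exI[of _ "\<lambda>_. 1"]) (simp flip: one_ereal_def)

text \<open>Convex weights reproduce affine functions, so averaging the minorant over the
  neighborhood gives its value at \<open>v\<close>.\<close>

lemma affine_minorant_local_convex_extension:
  assumes "\<And>z. z \<in> integral_neighborhood v \<Longrightarrow> ereal (q \<bullet> real_vec z + r) \<le> f z"
  shows "ereal (q \<bullet> v + r) \<le> local_convex_extension f v"
  unfolding local_convex_extension_def
proof (rule Inf_greatest, clarify)
  fix w :: "int ^ 'a \<Rightarrow> real"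
  let ?N = "integral_neighborhood v"
  assume w: "(\<Sum>y\<in>?N. w y *\<^sub>R real_vec y) = v" "sum w ?N = 1" "\<forall>y\<in>?N. 0 \<le> w y"
  have "q \<bullet> v + r = q \<bullet> (\<Sum>y\<in>?N. w y *\<^sub>R real_vec y) + sum w ?N * r"
    using w by simp
  also have "\<dots> = (\<Sum>y\<in>?N. w y * (q \<bullet> real_vec y + r))"
    by (simp add: inner_sum_right sum_distrib_right sum.distrib distrib_left)
  finally have "ereal (q \<bullet> v + r) = (\<Sum>y\<in>?N. ereal (w y) * ereal (q \<bullet> real_vec y + r))"
    by simp
  also have "\<dots> \<le> (\<Sum>y\<in>?N. ereal (w y) * f y)"
    using w(3) assms by (intro sum_mono ereal_mult_left_mono) auto
  finally show "ereal (q \<bullet> v + r) \<le> (\<Sum>y\<in>?N. ereal (w y) * f y)" .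
qed

text \<open>The form in which integral convexity is used below: with \<open>t = 1 / 2\<close> for
  midpoint closedness and with small \<open>t\<close> for localizing the subdifferential.\<close>

lemma integrally_convex_affine_minorant:
  fixes f :: "int ^ 'n \<Rightarrow> ereal"
  assumes "integrally_convex f" "f y = ereal k" "f y' = ereal k'" "0 \<le> t" "t \<le> 1"
    and "\<And>z. z \<in> integral_neighborhood ((1 - t) *\<^sub>R real_vec y + t *\<^sub>R real_vec y') \<Longrightarrow>
           ereal (q \<bullet> real_vec z + r) \<le> f z"
  shows "q \<bullet> ((1 - t) *\<^sub>R real_vec y + t *\<^sub>R real_vec y') + r \<le> (1 - t) * k + t * k'"
proof -
  let ?g = "local_convex_extension f"
  let ?v = "(1 - t) *\<^sub>R real_vec y + t *\<^sub>R real_vec y'"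
  have "ereal (q \<bullet> ?v + r) \<le> ?g ?v"
    using assms(6) by (rule affine_minorant_local_convex_extension)
  also have "\<dots> \<le> ereal (1 - t) * ?g (real_vec y) + ereal t * ?g (real_vec y')"
    using assms(1,4,5) by (simp add: integrally_convex_def ereal_convex_def)
  also have "\<dots> \<le> ereal (1 - t) * f y + ereal t * f y'"
    using assms(4,5)
    by (intro add_mono ereal_mult_left_mono local_convex_extension_real_vec_le) auto
  finally show ?thesis
    using assms(2,3) by simp
qed

section \<open>The local system of inequalities\<close>

text \<open>The pair \<open>(d, k)\<close> stands for the subgradient inequality at
  \<open>x + d\<close>. For finite \<open>f x\<close> the equation selects only directions with a
  finite value of \<open>f\<close>.\<close>

definition local_constraints :: "(int ^ 'n \<Rightarrow> ereal) \<Rightarrow> int ^ 'n \<Rightarrow> (('n \<Rightarrow> int) \<times> int) set" where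
  "local_constraints f x =
     {(d, k). (\<forall>i. d i \<in> {-1, 0, 1}) \<and> f (\<chi> i. x $ i + d i) = f x + ereal (of_int k)}"

text \<open>There are finitely many directions, and finiteness of \<open>f x\<close> makes
  \<open>k\<close> a function of \<open>d\<close>.\<close>

lemma finite_local_constraints:
  assumes "f x = ereal m"
  shows "finite (local_constraints f (x :: int ^ 'n))"
proof (rule finite_imageD[where f = fst])
  have "fst ` local_constraints f x \<subseteq> PiE UNIV (\<lambda>_. {-1, 0, 1})"
    by (auto simp: local_constraints_def PiE_def)
  then show "finite (fst ` local_constraints f x)"
    by (rule finite_subset) (intro finite_PiE, auto)
  show "inj_on fst (local_constraints f x)"
    using assms by (auto simp: inj_on_def local_constraints_def)
qed

lemma inner_real_vec_diff:
  "q \<bullet> real_vec z = q \<bullet> real_vec x + (\<Sum>i\<in>UNIV. q $ i * of_int (z $ i - x $ i))"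
  by (simp add: inner_vec_def right_diff_distrib sum_subtractf)

text \<open>Translates a minorant of increments over displacements from \<open>x\<close> into one of
  \<open>f\<close>; the intercept gives it the value \<open>f x + r\<close> at \<open>x\<close>.
  Where \<open>f\<close> is infinite the bound is trivial.\<close>

lemma local_constraints_minorant:
  fixes f :: "int ^ 'n \<Rightarrow> ereal"
  assumes "integer_valued f" "f x = ereal (of_int m)" "\<And>i. z $ i - x $ i \<in> {-1, 0, 1}"
    and "\<And>k. ((\<lambda>i. z $ i - x $ i), k) \<in> local_constraints f x \<Longrightarrow>
      (\<Sum>i\<in>UNIV. q $ i * of_int (z $ i - x $ i)) + r \<le> of_int k"
  shows "ereal (q \<bullet> real_vec z + (of_int m + r - q \<bullet> real_vec x)) \<le> f z"
proof (cases "f z = \<infinity>")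
  case False
  then obtain k :: int where k: "f z = ereal (of_int k)"
    using assms(1) unfolding integer_valued_def by blast
  have "((\<lambda>i. z $ i - x $ i), k - m) \<in> local_constraints f x"
    using assms(2,3) k by (simp add: local_constraints_def)
  from assms(4)[OF this] show ?thesis
    unfolding k inner_real_vec_diff[of q z x] by simp
qed simp

text \<open>Keeps the neighbors of a midpoint inside the unit cube around \<open>x\<close>, where
  \<open>local_constraints\<close> applies.\<close>

lemma abs_less_two_of_midpoint:
  fixes d d' z :: int
  assumes "-1 \<le> d" "d \<le> 1" "-1 \<le> d'" "d' \<le> 1" "\<bar>2 * z - (d + d')\<bar> < 2"
  shows "\<bar>z\<bar> < 2"
  using assms by linarith

text \<open>The nearness condition in \<open>midpoint_closed\<close> is membership in the integral
  neighborhood of the midpoint of \<open>x + d\<close> and \<open>x + d'\<close>, scaled by 2. The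
  claim is convexity at that midpoint, doubled.\<close>

lemma midpoint_closed_local_constraints:
  fixes f :: "int ^ 'n \<Rightarrow> ereal"
  assumes "integer_valued f" "integrally_convex f" "f x = ereal (of_int m)"
  shows "midpoint_closed UNIV (local_constraints f x)"
proof -
  let ?C = "local_constraints f x"
  have "(\<Sum>i\<in>UNIV. q i * of_int (d i + d' i)) + 2 * r \<le> real_of_int (k + k')"
    if dk: "(d, k) \<in> ?C" "(d', k') \<in> ?C"
      and minorant: "\<And>z l. (z, l) \<in> ?C \<Longrightarrow> (\<And>i. \<bar>2 * z i - (d i + d' i)\<bar> < 2) \<Longrightarrow>
            (\<Sum>i\<in>UNIV. q i * of_int (z i)) + r \<le> of_int l"
    for d k d' k' and q :: "'n \<Rightarrow> real" and r
  proof -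
    let ?y = "\<chi> i. x $ i + d i" and ?y' = "\<chi> i. x $ i + d' i" and ?q = "\<chi> i. q i"
    let ?mid = "(1 - 1 / 2) *\<^sub>R real_vec ?y + (1 / 2) *\<^sub>R real_vec ?y'"
    have fy: "f ?y = ereal (of_int (m + k))" "f ?y' = ereal (of_int (m + k'))"
      using dk assms(3) by (auto simp: local_constraints_def)
    have "?q \<bullet> ?mid + (of_int m + r - ?q \<bullet> real_vec x)
        \<le> (1 - 1 / 2) * of_int (m + k) + 1 / 2 * of_int (m + k')"
    proof (rule integrally_convex_affine_minorant[OF assms(2) fy])
      fix z :: "int ^ 'n"
      assume z: "z \<in> integral_neighborhood ?mid"
      have near: "\<bar>2 * (z $ i - x $ i) - (d i + d' i)\<bar> < 2" for i
      proof -
        have "\<bar>?mid $ i - of_int (z $ i)\<bar> < 1"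
          using z by (simp add: integral_neighborhood_def)
        then have "\<bar>real_of_int (2 * (z $ i - x $ i) - (d i + d' i))\<bar> < 2"
          by (simp add: field_simps)
        then show ?thesis
          by linarith
      qed
      have unit: "z $ i - x $ i \<in> {-1, 0, 1}" for i
      proof -
        have "d i \<in> {-1, 0, 1}" "d' i \<in> {-1, 0, 1}"
          using dk by (auto simp: local_constraints_def)
        then have "-1 \<le> d i" "d i \<le> 1" "-1 \<le> d' i" "d' i \<le> 1"
          by auto
        then have "\<bar>z $ i - x $ i\<bar> < 2"
          using abs_less_two_of_midpoint near by blast
        then show ?thesis
          by auto
      qed
      show "ereal (?q \<bullet> real_vec z + (of_int m + r - ?q \<bullet> real_vec x)) \<le> f z"
        using minorant[of "\<lambda>i. z $ i - x $ i"] near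
        by (intro local_constraints_minorant[OF assms(1,3) unit]) simp
    qed auto
    moreover have "2 * (?q \<bullet> ?mid) = ?q \<bullet> real_vec ?y + ?q \<bullet> real_vec ?y'"
      by (simp add: inner_add_right)
    moreover have "\<dots> = 2 * (?q \<bullet> real_vec x) + (\<Sum>i\<in>UNIV. q i * of_int (d i + d' i))"
      unfolding inner_real_vec_diff[of ?q ?y x] inner_real_vec_diff[of ?q ?y' x]
      by (simp add: distrib_left sum.distrib)
    ultimately show ?thesis
      unfolding of_int_add by argo
  qed
  then show ?thesis
    by (intro midpoint_closedI) simp
qed

text \<open>Conversely to restriction, a short move from \<open>x\<close> towards \<open>y\<close>
  sees only neighbors in the unit cube around \<open>x\<close>. The local inequalities make an
  affine minorant there, and convexity along the segment carries it to \<open>y\<close> after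
  division by \<open>t\<close>.\<close>

lemma subdifferential_eq_local_constraints:
  fixes f :: "int ^ 'n \<Rightarrow> ereal"
  assumes "integer_valued f" "integrally_convex f" "f x = ereal (of_int m)"
  shows "subdifferential f x =
    {p. \<forall>(d, k)\<in>local_constraints f x. (\<Sum>i\<in>UNIV. p $ i * of_int (d i)) \<le> of_int k}"
proof (intro set_eqI iffI)
  fix p
  assume p: "p \<in> subdifferential f x"
  have "(\<Sum>i\<in>UNIV. p $ i * of_int (d i)) \<le> of_int k" if dk: "(d, k) \<in> local_constraints f x" for d k
  proof -
    let ?y = "\<chi> i. x $ i + d i"
    have "ereal (p \<bullet> (real_vec ?y - real_vec x)) \<le> f ?y - f x"
      using p by (simp add: subdifferential_def)
    then show ?thesis
      using dk assms(3) by (simp add: local_constraints_def inner_vec_def)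
  qed
  then show "p \<in> {p. \<forall>(d, k)\<in>local_constraints f x. (\<Sum>i\<in>UNIV. p $ i * of_int (d i)) \<le> of_int k}"
    by auto
next
  fix p :: "real ^ 'n"
  assume "p \<in> {p. \<forall>(d, k)\<in>local_constraints f x. (\<Sum>i\<in>UNIV. p $ i * of_int (d i)) \<le> of_int k}"
  then have p: "(\<Sum>i\<in>UNIV. p $ i * of_int (d i)) \<le> of_int k" if "(d, k) \<in> local_constraints f x" for d k
    using that by auto
  have "ereal (p \<bullet> (real_vec y - real_vec x)) \<le> f y - f x" for y
  proof (cases "f y = \<infinity>")
    case True
    then show ?thesis
      using assms(3) by simp
  next
    case False
    then obtain k :: int where k: "f y = ereal (of_int k)"
      using assms(1) unfolding integer_valued_def by blast
    \<comment> \<open>Small enough that every coordinate moves by less than 1; the summand 1 makes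
      this strict and covers \<open>y = x\<close>.\<close>
    define t where "t = 1 / (1 + (\<Sum>i\<in>UNIV. \<bar>real_of_int (y $ i - x $ i)\<bar>))"
    have t: "0 < t" "t \<le> 1"
      by (auto simp: t_def add_pos_nonneg sum_nonneg)
    have small: "\<bar>t * real_of_int (y $ i - x $ i)\<bar> < 1" for i
    proof -
      have "\<bar>real_of_int (y $ i - x $ i)\<bar> \<le> (\<Sum>i\<in>UNIV. \<bar>real_of_int (y $ i - x $ i)\<bar>)"
        by (rule member_le_sum) auto
      then show ?thesis
        by (simp add: t_def abs_mult divide_simps)
    qed
    let ?v = "(1 - t) *\<^sub>R real_vec x + t *\<^sub>R real_vec y"
    have "p \<bullet> ?v + (of_int m + 0 - p \<bullet> real_vec x) \<le> (1 - t) * of_int m + t * of_int k"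
    proof (rule integrally_convex_affine_minorant[OF assms(2,3) k])
      fix z :: "int ^ 'n"
      assume z: "z \<in> integral_neighborhood ?v"
      have unit: "z $ i - x $ i \<in> {-1, 0, 1}" for i
      proof -
        have "\<bar>?v $ i - of_int (z $ i)\<bar> < 1"
          using z by (simp add: integral_neighborhood_def)
        moreover have "?v $ i = of_int (x $ i) + t * real_of_int (y $ i - x $ i)"
          by (simp add: algebra_simps)
        ultimately have "\<bar>real_of_int (z $ i - x $ i)\<bar> < 2"
          using small[of i] by simp
        then show ?thesis
          by auto
      qed
      show "ereal (p \<bullet> real_vec z + (of_int m + 0 - p \<bullet> real_vec x)) \<le> f z"
        using p[of "\<lambda>i. z $ i - x $ i"]
        by (intro local_constraints_minorant[OF assms(1,3) unit]) simp
    qed (use t in auto)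
    then have "t * (p \<bullet> (real_vec y - real_vec x)) \<le> t * of_int (k - m)"
      by (simp add: inner_add_right inner_diff_right algebra_simps)
    then show ?thesis
      using t assms(3) k by simp
  qed
  then show "p \<in> subdifferential f x"
    by (simp add: subdifferential_def)
qed

section \<open>Polyhedrality\<close>

lemma polyhedron_coord_ge: "polyhedron {p :: real ^ 'n. c \<le> p $ i}"
  using polyhedron_halfspace_ge[where a = "axis i 1 :: real ^ 'n" and b = c] by (simp add: inner_axis')

lemma polyhedron_coord_le: "polyhedron {p :: real ^ 'n. p $ i \<le> c}"
  using polyhedron_halfspace_le[where a = "axis i 1 :: real ^ 'n" and b = c] by (simp add: inner_axis')

lemma polyhedron_integral_box:
  fixes B :: "(real ^ 'n) set"
  assumes "integral_box B"
  shows "polyhedron B"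
proof -
  obtain \<alpha> \<beta> :: "ereal ^ 'n" where \<alpha>: "\<And>i. \<alpha> $ i = -\<infinity> \<or> (\<exists>k::int. \<alpha> $ i = ereal (of_int k))"
    and \<beta>: "\<And>i. \<beta> $ i = \<infinity> \<or> (\<exists>k::int. \<beta> $ i = ereal (of_int k))"
    and B: "B = {p. \<forall>i. \<alpha> $ i \<le> ereal (p $ i) \<and> ereal (p $ i) \<le> \<beta> $ i}"
    using assms unfolding integral_box_def by blast
  have "polyhedron {p :: real ^ 'n. \<alpha> $ i \<le> ereal (p $ i)}" for i
    using \<alpha>[of i] polyhedron_coord_ge by auto
  moreover have "polyhedron {p :: real ^ 'n. ereal (p $ i) \<le> \<beta> $ i}" for i
    using \<beta>[of i] polyhedron_coord_le by auto
  moreover have "B = \<Inter> (range (\<lambda>i. {p. \<alpha> $ i \<le> ereal (p $ i)} \<inter> {p. ereal (p $ i) \<le> \<beta> $ i}))"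
    unfolding B by auto
  ultimately show ?thesis
    by (auto intro!: polyhedron_Inter polyhedron_Int)
qed

lemma polyhedron_subdifferential:
  fixes f :: "int ^ 'n \<Rightarrow> ereal"
  assumes "integer_valued f" "integrally_convex f" "f x = ereal (of_int m)"
  shows "polyhedron (subdifferential f x)"
proof -
  let ?H = "\<lambda>(d, k :: int). {p :: real ^ 'n. (\<chi> i. real_of_int (d i)) \<bullet> p \<le> of_int k}"
  have "subdifferential f x = \<Inter> (?H ` local_constraints f x)"
    unfolding subdifferential_eq_local_constraints[OF assms]
    by (auto simp: inner_vec_def mult.commute)
  then show ?thesis
    using finite_local_constraints[of f x] assms(3)
    by (auto intro!: polyhedron_Inter polyhedron_halfspace_le)
qed

section \<open>Truncated boxes and extreme points\<close>

text \<open>Infinite bounds become \<open>-M\<close> or \<open>M\<close>, giving the finite integral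
  bounds that \<open>feasible\<close> asks for. The truncated box may be empty, so
  \<open>a i \<le> b i\<close> is not claimed.\<close>

lemma integral_box_truncate:
  fixes B :: "(real ^ 'n) set" and M :: int
  assumes "integral_box B"
  obtains a b :: "'n \<Rightarrow> int" where
    "\<And>p. (\<forall>i. of_int (a i) \<le> p $ i \<and> p $ i \<le> of_int (b i)) \<longleftrightarrow> p \<in> B \<and> (\<forall>i. \<bar>p $ i\<bar> \<le> of_int M)"
proof -
  obtain \<alpha> \<beta> :: "ereal ^ 'n" where \<alpha>: "\<And>i. \<alpha> $ i = -\<infinity> \<or> (\<exists>k::int. \<alpha> $ i = ereal (of_int k))"
    and \<beta>: "\<And>i. \<beta> $ i = \<infinity> \<or> (\<exists>k::int. \<beta> $ i = ereal (of_int k))"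
    and B: "B = {p. \<forall>i. \<alpha> $ i \<le> ereal (p $ i) \<and> ereal (p $ i) \<le> \<beta> $ i}"
    using assms unfolding integral_box_def by blast
  have "\<exists>a::int. \<forall>t. of_int a \<le> t \<longleftrightarrow> \<alpha> $ i \<le> ereal t \<and> - of_int M \<le> t" for i
    using \<alpha>[of i]
  proof
    assume "\<alpha> $ i = -\<infinity>"
    then show ?thesis
      by (intro exI[of _ "-M"]) simp
  next
    assume "\<exists>k::int. \<alpha> $ i = ereal (of_int k)"
    then obtain k :: int where "\<alpha> $ i = ereal (of_int k)" ..
    then show ?thesis
      by (intro exI[of _ "max k (-M)"]) (simp add: of_int_max)
  qed
  then obtain a :: "'n \<Rightarrow> int"
    where a: "\<And>i t. of_int (a i) \<le> t \<longleftrightarrow> \<alpha> $ i \<le> ereal t \<and> - of_int M \<le> t"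
    by metis
  have "\<exists>b::int. \<forall>t. t \<le> of_int b \<longleftrightarrow> ereal t \<le> \<beta> $ i \<and> t \<le> of_int M" for i
    using \<beta>[of i]
  proof
    assume "\<beta> $ i = \<infinity>"
    then show ?thesis
      by (intro exI[of _ M]) simp
  next
    assume "\<exists>k::int. \<beta> $ i = ereal (of_int k)"
    then obtain k :: int where "\<beta> $ i = ereal (of_int k)" ..
    then show ?thesis
      by (intro exI[of _ "min k M"]) (simp add: of_int_min)
  qed
  then obtain b :: "'n \<Rightarrow> int"
    where b: "\<And>i t. t \<le> of_int (b i) \<longleftrightarrow> ereal t \<le> \<beta> $ i \<and> t \<le> of_int M"
    by metis
  show thesis
    by (rule that[of a b]) (auto simp: a b B abs_le_iff minus_le_iff)
qed

lemma integer_extreme_point_truncated: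
  fixes f :: "int ^ 'n \<Rightarrow> ereal" and M :: int
  assumes "integer_valued f" "integrally_convex f" "f x = ereal (of_int m)" "integral_box B"
    and "p \<in> subdifferential f x \<inter> B \<inter> {p. \<forall>i. \<bar>p $ i\<bar> \<le> of_int M}"
  shows "\<exists>v. v extreme_point_of (subdifferential f x \<inter> B \<inter> {p. \<forall>i. \<bar>p $ i\<bar> \<le> of_int M}) \<and>
    integer_vector v"
proof -
  let ?P = "subdifferential f x \<inter> B \<inter> {p. \<forall>i. \<bar>p $ i\<bar> \<le> of_int M}"
  let ?C = "local_constraints f x"
  obtain a b :: "'n \<Rightarrow> int" where
    ab: "\<And>p. (\<forall>i. of_int (a i) \<le> p $ i \<and> p $ i \<le> of_int (b i)) \<longleftrightarrow> p \<in> B \<and> (\<forall>i. \<bar>p $ i\<bar> \<le> of_int M)"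
    using integral_box_truncate[OF assms(4)] by blast
  \<comment> \<open>The truncated set is the solution set of an integral system to which elimination
    applies.\<close>
  have P: "p \<in> ?P \<longleftrightarrow> feasible UNIV a b ?C (($) p)" for p
    using ab[of p] unfolding feasible_def subdifferential_eq_local_constraints[OF assms(1-3)] by auto
  have C: "finite ?C" "\<forall>(d, k)\<in>?C. \<forall>i\<in>UNIV. d i \<in> {-1, 0, 1}"
    using finite_local_constraints[of f x, OF assms(3)] by (auto simp: local_constraints_def)
  obtain m where m: "feasible UNIV a b ?C (\<lambda>i. of_int (m i))"
    and ext: "\<And>s t u. feasible UNIV a b ?C s \<Longrightarrow> feasible UNIV a b ?C t \<Longrightarrow> 0 < u \<Longrightarrow> u < 1 \<Longrightarrow>
        (\<forall>i. of_int (m i) = (1 - u) * s i + u * t i) \<Longrightarrow>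
        (\<forall>i. s i = of_int (m i) \<and> t i = of_int (m i))"
    using integral_feasible_exists[OF finite C midpoint_closed_local_constraints[OF assms(1-3)]
        P[THEN iffD1, OF assms(5)]]
    by (elim exE conjE) (rule that, assumption, blast)
  define v :: "real ^ 'n" where "v = (\<chi> i. of_int (m i))"
  have "v \<notin> open_segment s t" if st: "s \<in> ?P" "t \<in> ?P" for s t
  proof
    assume "v \<in> open_segment s t"
    then obtain u where u: "s \<noteq> t" "0 < u" "u < 1" "v = (1 - u) *\<^sub>R s + u *\<^sub>R t"
      by (auto simp: in_segment)
    have "of_int (m i) = (1 - u) * s $ i + u * t $ i" for i
      using arg_cong[OF u(4), of "\<lambda>w. w $ i"] by (simp add: v_def)
    then have "\<forall>i. s $ i = of_int (m i) \<and> t $ i = of_int (m i)"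
      by (intro ext[OF st[THEN P[THEN iffD1]] u(2,3)] allI)
    then have "s = t"
      by (simp add: vec_eq_iff)
    with u(1) show False ..
  qed
  moreover have "($) v = (\<lambda>i. of_int (m i))"
    by (auto simp: v_def)
  then have "v \<in> ?P"
    unfolding P by (simp only: m)
  ultimately have "v extreme_point_of ?P"
    unfolding extreme_point_of_def by (intro conjI ballI)
  moreover have "integer_vector v"
    by (simp add: integer_vector_def v_def)
  ultimately show ?thesis
    by (intro exI conjI)
qed

section \<open>Passage to arbitrary boxes\<close>

theorem theorem1p2:
  fixes f :: "int ^ 'n \<Rightarrow> ereal" and x :: "int ^ 'n" and B :: "(real ^ 'n) set"
  assumes "integer_valued f"
    and "integrally_convex f"
    and "x \<in> eff_dom f"
    and "integral_box B"
    and "subdifferential f x \<inter> B \<noteq> {}"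
  shows "polyhedron (subdifferential f x \<inter> B) \<and>
         (\<exists>p \<in> subdifferential f x \<inter> B. integer_vector p) \<and>
         (bounded (subdifferential f x \<inter> B) \<longrightarrow>
            (\<exists>v. v extreme_point_of (subdifferential f x \<inter> B) \<and> integer_vector v))"
proof -
  let ?P = "subdifferential f x \<inter> B"
  let ?box = "\<lambda>M :: int. {p :: real ^ 'n. \<forall>i. \<bar>p $ i\<bar> \<le> of_int M}"
  obtain m :: int where m: "f x = ereal (of_int m)"
    using assms(1,3) unfolding integer_valued_def eff_dom_def by auto
  obtain p where p: "p \<in> ?P"
    using assms(5) by blast
  have norm_box: "q \<in> ?box \<lceil>K\<rceil>" if "norm q \<le> K" for q :: "real ^ 'n" and K
    using order_trans[OF order_trans[OF component_le_norm_cart that] le_of_int_ceiling]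
    by (intro CollectI allI)
  note ext = integer_extreme_point_truncated[OF assms(1,2) m assms(4)]
  have "polyhedron ?P"
    using polyhedron_subdifferential[OF assms(1,2) m] polyhedron_integral_box[OF assms(4)]
    by (rule polyhedron_Int)
  moreover have "\<exists>p \<in> ?P. integer_vector p"
  proof -
    \<comment> \<open>This truncation retains \<open>p\<close>, so it is nonempty. The integer point
      found may fail to be extreme in \<open>?P\<close>, but it belongs to
      \<open>?P\<close>.\<close>
    have "p \<in> ?P \<inter> ?box \<lceil>norm p\<rceil>"
      using p norm_box[OF order_refl] by (rule IntI)
    from ext[OF this] obtain v where "v extreme_point_of (?P \<inter> ?box \<lceil>norm p\<rceil>)" "integer_vector v"
      by (elim exE conjE)
    then show ?thesis
      by (intro bexI[of _ v]) (simp_all add: extreme_point_of_def)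
  qed
  moreover have "\<exists>v. v extreme_point_of ?P \<and> integer_vector v" if "bounded ?P"
  proof -
    \<comment> \<open>A truncation beyond the norm bound leaves \<open>?P\<close> unchanged, so
      extremality holds in \<open>?P\<close> itself.\<close>
    obtain K where "\<forall>q\<in>?P. norm q \<le> K"
      using \<open>bounded ?P\<close> unfolding bounded_iff by blast
    then have "?P \<subseteq> ?box \<lceil>K\<rceil>"
      by (intro subsetI norm_box) (rule bspec)
    then have "?P \<inter> ?box \<lceil>K\<rceil> = ?P"
      by (rule Int_absorb2)
    from ext[of p "\<lceil>K\<rceil>", unfolded this, OF p] show ?thesis .
  qed
  ultimately show ?thesis
    by (intro conjI impI)
qed

end
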